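(* Let $X,Y$ be Polish spaces, $\mu\in\mathcal P(X)$, $\nu\in\mathcal P(Y)$ Borel probability measures, and $c:X\times Y\to[0,+\infty]$ lower semicontinuous such that, for some $\mathcal K<+\infty$, $\sup_{y}\int_X c(x,y)\,d\mu(x)\le\mathcal K$ and $\sup_{x}\int_Y c(x,y)\,d\nu(y)\le\mathcal K$. For every $\varepsilon>0$ let $(u_\varepsilon,v_\varepsilon)$ be a maximizer of $\mathcal D_\varepsilon$ over $L^1_\mu\times L^1_\nu$ with $-\mathcal K\le u_\varepsilon,v_\varepsilon\le\mathcal K$. Then there exist a sequence $\varepsilon_k\to0^+$ and functions $u^*\in L^\infty_\mu$, $v^*\in L^\infty_\nu$ such that $u_{\varepsilon_k}\rightharpoonup u^*$ weakly* in $L^\infty_\mu$, $v_{\varepsilon_k}\rightharpoonup v^*$ weakly* in $L^\infty_\nu$, and $$\lim_{k\to\infty}\mathcal D_{\varepsilon_k}(u_{\varepsilon_k},v_{\varepsilon_k})=\int_X u^*\,d\mu+\int_Y v^*\,d\nu.$$ Moreover, the pair $(u^*,v^* )$ is a maximizer of $$\max_{(u,v)\in\mathcal B'}\int_X u\,d\mu+\int_Y v\,d\nu,$$ where $\mathcal B'=\{(u,v)\in L^1_\mu\times L^1_\nu:\ u(x)+v(y)\le c(x,y)\ \text{for } \mu\otimes\nu\text{-a.e. }(x,y)\}$ (in particular $(u^*,v^* )\in\mathcal B'$).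
   Context: For $u\in L^1_\mu$, $v\in L^1_\nu$, $$\mathcal D_\varepsilon(u,v)=\int_X u\,d\mu+\int_Y v\,d\nu-\varepsilon\int_{X\times Y}e^{\frac{u(x)+v(y)-c(x,y)}{\varepsilon}}\,d(\mu\otimes\nu)+\varepsilon\in[-\infty,+\infty),$$ with $e^{-\infty}=0$. Under the stated assumptions a maximizer of $\mathcal D_\varepsilon$ with $-\mathcal K\le u_\varepsilon,v_\varepsilon\le\mathcal K$ exists for every $\varepsilon>0$ (maximizers are unique up to replacing $(u,v)$ by $(u+a,v-a)$, $a\in\mathbb R$). *)

theory Defs
  imports "HOL-Probability.Probability"
begin

text \<open>Elements of \<open>L\<^sup>1\<close> and \<open>L\<^sup>\<infinity>\<close> are represented by real-valued functions rather than by
  classes modulo null sets; all bounds on them are accordingly meant almost everywhere.\<close>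

definition lower_semicontinuous :: "('a::topological_space \<Rightarrow> ennreal) \<Rightarrow> bool" where
  "lower_semicontinuous c \<longleftrightarrow> (\<forall>t. open {z. t < c z})"

definition exp_ext :: "ereal \<Rightarrow> ennreal" where
  "exp_ext t = (case t of ereal r \<Rightarrow> ennreal (exp r) | PInfty \<Rightarrow> \<infinity> | MInfty \<Rightarrow> 0)"

text \<open>The dual functional of entropic optimal transport. If \<open>c (x, y) = \<infinity>\<close>, the exponent is
  \<open>-\<infinity>\<close> and the integrand vanishes. For integrable \<open>u\<close>, \<open>v\<close> only the exponential integral may be
  infinite, in which case the value is \<open>-\<infinity>\<close>; it is never \<open>+\<infinity>\<close>.\<close>

definition entropic_dual ::
  "'a measure \<Rightarrow> 'b measure \<Rightarrow> ('a \<times> 'b \<Rightarrow> ennreal) \<Rightarrow> real \<Rightarrow> ('a \<Rightarrow> real) \<Rightarrow> ('b \<Rightarrow> real) \<Rightarrow> ereal"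
where
  "entropic_dual \<mu> \<nu> c \<epsilon> u v =
     ereal (\<integral>x. u x \<partial>\<mu>) + ereal (\<integral>y. v y \<partial>\<nu>)
     - ereal \<epsilon> * enn2ereal (\<integral>\<^sup>+ (x, y). exp_ext ((ereal (u x + v y) - enn2ereal (c (x, y))) / ereal \<epsilon>) \<partial>(\<mu> \<Otimes>\<^sub>M \<nu>))
     + ereal \<epsilon>"

definition entropic_maximizer ::
  "'a measure \<Rightarrow> 'b measure \<Rightarrow> ('a \<times> 'b \<Rightarrow> ennreal) \<Rightarrow> real \<Rightarrow> ('a \<Rightarrow> real) \<Rightarrow> ('b \<Rightarrow> real) \<Rightarrow> bool"
where
  "entropic_maximizer \<mu> \<nu> c \<epsilon> u v \<longleftrightarrow>
     is_arg_max (\<lambda>(u, v). entropic_dual \<mu> \<nu> c \<epsilon> u v)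
       (\<lambda>(u, v). integrable \<mu> u \<and> integrable \<nu> v) (u, v)"

definition Linfty :: "'a measure \<Rightarrow> ('a \<Rightarrow> real) set" where
  "Linfty M = {f \<in> borel_measurable M. \<exists>C. AE x in M. \<bar>f x\<bar> \<le> C}"

text \<open>Weak* convergence in \<open>L\<^sup>\<infinity>\<close>, viewed as the dual of \<open>L\<^sup>1\<close>.\<close>

definition weak_star_converges :: "'a measure \<Rightarrow> (nat \<Rightarrow> 'a \<Rightarrow> real) \<Rightarrow> ('a \<Rightarrow> real) \<Rightarrow> bool" where
  "weak_star_converges M f g \<longleftrightarrow>
     (\<forall>k. f k \<in> Linfty M) \<and> g \<in> Linfty M \<and>
     (\<forall>\<phi>. integrable M \<phi> \<longrightarrow> (\<lambda>k. \<integral>x. f k x * \<phi> x \<partial>M) \<longlonglongrightarrow> (\<integral>x. g x * \<phi> x \<partial>M))"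

definition dual_feasible ::
  "'a measure \<Rightarrow> 'b measure \<Rightarrow> ('a \<times> 'b \<Rightarrow> ennreal) \<Rightarrow> (('a \<Rightarrow> real) \<times> ('b \<Rightarrow> real)) set"
where
  "dual_feasible \<mu> \<nu> c = {(u, v). integrable \<mu> u \<and> integrable \<nu> v \<and>
     (AE (x, y) in \<mu> \<Otimes>\<^sub>M \<nu>. ereal (u x + v y) \<le> enn2ereal (c (x, y)))}"

end

(*
  Bounded sets of L^infinity are weak* sequentially compact over a Borel sigma-algebra with a
  countable generator: a diagonal argument makes the integrals over the sets of a countable
  generator stable under intersection converge, Dynkin's lemma spreads this to all Borel sets, and
  Radon-Nikodym turns the setwise limit into a bounded density.

  Comparing a maximizer (u, v) of D_eps with (u - eps, v) shows that its exponential integral is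
  at most 2. Hence the penalty term vanishes as eps -> 0. Since t <= exp t, also the integral of
  u + v - c over any measurable set is at most 2 eps, and therefore u* + v* <= c almost
  everywhere. Finally, every pair (u, v) in B' satisfies D_eps(u, v) >= int u + int v, so its value
  is at most D_eps(u_eps, v_eps), which tends to int u* + int v*.
*)
theory Submission
  imports Defs "HOL-Complex_Analysis.Great_Picard"
begin


section \<open>A countable generator of the Borel sigma-algebra\<close>

text \<open>Close a countable basis under finite intersections. Countability serves the diagonal
  extraction, stability under intersection serves Dynkin's lemma, and the whole space in
  \<open>G\<close> gives the closure under complements there.\<close>

lemma countable_Int_stable_generator_borel:
  obtains G :: "'a::second_countable_topology set set"
  where "countable G" "Int_stable G" "UNIV \<in> G" "sets borel = sigma_sets UNIV G"
proof -
  obtain B :: "'a set set" where B: "countable B" "topological_basis B"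
    using ex_countable_basis by blast
  define G where "G = Inter ` {F. finite F \<and> F \<subseteq> B}"
  have "B \<subseteq> G"
  proof
    fix b assume "b \<in> B"
    then have "\<Inter>{b} \<in> G" unfolding G_def by (intro imageI) auto
    then show "b \<in> G" by simp
  qed
  have G_borel: "S \<in> sets borel" if "S \<in> G" for S
    using that topological_basis_open[OF B(2)] unfolding G_def
    by (force intro!: borel_open open_Inter)
  have eq: "sets borel = sigma_sets UNIV B"
    by (simp add: borel_eq_countable_basis[OF B])
  show ?thesis
  proof
    show "countable G"
      unfolding G_def by (intro countable_image countable_Collect_finite_subset B)
    show "Int_stable G"
      unfolding Int_stable_def
    proof (intro ballI)
      fix S T assume "S \<in> G" "T \<in> G"
      then obtain F F' where F: "finite F" "F \<subseteq> B" "S = \<Inter>F" "finite F'" "F' \<subseteq> B" "T = \<Inter>F'"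
        by (auto simp: G_def)
      then have "S \<inter> T = \<Inter>(F \<union> F')" by auto
      with F show "S \<inter> T \<in> G" unfolding G_def by (intro image_eqI[of _ _ "F \<union> F'"]) auto
    qed
    \<comment> \<open>The intersection of the empty family is the whole space.\<close>
    have "\<Inter>{} \<in> G" unfolding G_def by (intro imageI) auto
    then show "UNIV \<in> G" by simp
    show "sets borel = sigma_sets UNIV G"
    proof
      show "sets borel \<subseteq> sigma_sets UNIV G"
        unfolding eq using \<open>B \<subseteq> G\<close> by (rule sigma_sets_mono')
      have "sigma_sets UNIV G \<subseteq> sigma_sets UNIV (sets borel)"
        by (rule sigma_sets_mono') (use G_borel in blast)
      then show "sigma_sets UNIV G \<subseteq> sets borel"
        using sets.sigma_sets_eq[of "borel :: 'a measure"] by simp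
    qed
  qed
qed

section \<open>Setwise convergence of bounded functions and the density of the limit\<close>

lemma (in finite_measure) integrable_bounded_mult:
  fixes f g :: "'a \<Rightarrow> real"
  assumes "f \<in> borel_measurable M" "AE x in M. \<bar>f x\<bar> \<le> C" "integrable M g"
  shows "integrable M (\<lambda>x. f x * g x)"
proof (rule Bochner_Integration.integrable_bound[of _ "\<lambda>x. C * g x"])
  show "AE x in M. norm (f x * g x) \<le> norm (C * g x)"
    using assms(2) by eventually_elim (auto simp: abs_mult intro!: mult_right_mono)
qed (use assms in auto)

lemma (in finite_measure) set_integrable_bounded:
  fixes f :: "'a \<Rightarrow> real"
  assumes "f \<in> borel_measurable M" "AE x in M. \<bar>f x\<bar> \<le> C" "A \<in> sets M"
  shows "set_integrable M A f"
proof -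
  have "integrable M f"
    using assms by (intro integrable_const_bound[of _ C]) auto
  then show ?thesis
    using assms(3) unfolding set_integrable_def by (rule integrable_mult_indicator[rotated])
qed

lemma (in finite_measure) set_integral_bounded_le:
  fixes f :: "'a \<Rightarrow> real"
  assumes "f \<in> borel_measurable M" "AE x in M. \<bar>f x\<bar> \<le> C" "A \<in> sets M"
  shows "\<bar>LINT x:A|M. f x\<bar> \<le> C * measure M A"
proof -
  have i: "set_integrable M A f"
    using assms by (rule set_integrable_bounded)
  have "\<bar>LINT x:A|M. f x\<bar> \<le> (LINT x:A|M. \<bar>f x\<bar>)"
    using set_integral_norm_bound[OF i] by simp
  also have "\<dots> \<le> (LINT x:A|M. C)"
    using assms i
    by (intro set_integral_mono_AE set_integrable_abs) (auto simp: set_integrable_def emeasure_eq_measure)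
  also have "\<dots> = C * measure M A"
    using assms(3) by (simp add: set_integral_const)
  finally show ?thesis .
qed

text \<open>Dominated convergence of the series over a disjoint union, the dominating terms being
  \<open>C * measure M (A i)\<close>.\<close>

lemma (in finite_measure) tendsto_set_integral_disjoint_UN:
  fixes f :: "nat \<Rightarrow> 'a \<Rightarrow> real"
  assumes "\<And>k. f k \<in> borel_measurable M" "\<And>k. AE x in M. \<bar>f k x\<bar> \<le> C"
    and A: "range A \<subseteq> sets M" "disjoint_family A"
    and L: "\<And>i. (\<lambda>k. LINT x:A i|M. f k x) \<longlonglongrightarrow> L i"
  shows "(\<lambda>k. LINT x:(\<Union>i. A i)|M. f k x) \<longlonglongrightarrow> (\<Sum>i. L i)" "summable (\<lambda>i. \<bar>L i\<bar>)"
proof -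
  have A_i: "A i \<in> sets M" for i using A(1) by auto
  have "summable (\<lambda>i. measure M (A i))"
    using finite_measure_UNION[OF A] by (rule sums_summable)
  then have "summable (\<lambda>i. C * measure M (A i))"
    by (rule summable_mult)
  note * = tannerys_theorem[OF L _ this]
  have ev: "eventually (\<lambda>(i, k). norm (LINT x:A i|M. f k x) \<le> C * measure M (A i)) (at_top \<times>\<^sub>F sequentially)"
    using assms(1,2) A_i by (intro always_eventually) (auto intro: set_integral_bounded_le)
  have "(LINT x:(\<Union>i. A i)|M. f k x) = (\<Sum>i. LINT x:A i|M. f k x)" for k
    using A assms(1,2) A_i
    by (intro lebesgue_integral_countable_add set_integrable_bounded) (auto simp: disjoint_family_on_def)
  then show "(\<lambda>k. LINT x:(\<Union>i. A i)|M. f k x) \<longlonglongrightarrow> (\<Sum>i. L i)" "summable (\<lambda>i. \<bar>L i\<bar>)"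
    using *[OF ev] by auto
qed

text \<open>The sets whose integrals converge along a fixed subsequence form a Dynkin system:
  complements are handled by subtracting from the integral over \<open>space M\<close>, disjoint
  unions by dominated convergence of the series. It is therefore enough to extract a subsequence for
  the countable, intersection-stable \<open>G\<close>.\<close>

lemma (in finite_measure) setwise_convergent_subsequence:
  fixes f :: "nat \<Rightarrow> 'a \<Rightarrow> real"
  assumes gen: "countable G" "Int_stable G" "space M \<in> G" "G \<subseteq> Pow (space M)"
      "sets M = sigma_sets (space M) G"
    and meas: "\<And>k. f k \<in> borel_measurable M" and bound: "\<And>k. AE x in M. \<bar>f k x\<bar> \<le> C"
  obtains r where "strict_mono (r::nat \<Rightarrow> nat)"
    "\<And>A. A \<in> sets M \<Longrightarrow> convergent (\<lambda>k. LINT x:A|M. f (r k) x)"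
proof -
  \<comment> \<open>One bound for all \<open>A\<close> and \<open>k\<close>, as the diagonal
    argument requires. The absolute value appears because no sign of \<open>C\<close> is
    assumed.\<close>
  have b: "norm (LINT x:A|M. f k x) \<le> \<bar>C\<bar> * measure M (space M)" if "A \<in> G" for A k
  proof -
    have "A \<in> sets M" using that gen(5) by auto
    then have "norm (LINT x:A|M. f k x) \<le> C * measure M A"
      using set_integral_bounded_le[OF meas bound] by simp
    also have "\<dots> \<le> \<bar>C\<bar> * measure M (space M)"
      by (intro mult_mono) (auto intro: bounded_measure)
    finally show ?thesis .
  qed
  \<comment> \<open>Diagonal argument with the members of \<open>G\<close> in the role of points:
    the set functions given by the integrals of \<open>f k\<close> are uniformly bounded on the
    countable \<open>G\<close>.\<close>
  obtain r :: "nat \<Rightarrow> nat" where r: "strict_mono r"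
    and conv: "\<And>A. A \<in> G \<Longrightarrow> \<exists>l. (\<lambda>k. LINT x:A|M. f (r k) x) \<longlonglongrightarrow> l"
    using function_convergent_subsequence[OF gen(1), of "\<lambda>k A. LINT x:A|M. f k x", OF b] by blast
  show ?thesis
  proof (rule that[OF r])
    fix A assume "A \<in> sets M"
    then have "A \<in> sigma_sets (space M) G" using gen(5) by simp
    from gen(2,4) this show "convergent (\<lambda>k. LINT x:A|M. f (r k) x)"
    proof (induction rule: sigma_sets_induct_disjoint)
      case (basic A)
      then show ?case using conv by (auto simp: convergent_def)
    next
      case empty
      show ?case by (simp add: set_lebesgue_integral_def convergent_const)
    next
      case (compl A)
      then have A: "A \<in> sets M" using gen(5) by simp
      have "(LINT x:space M - A|M. f (r k) x) = (LINT x:space M|M. f (r k) x) - (LINT x:A|M. f (r k) x)" for k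
      proof -
        have "(LINT x:(space M - A) \<union> A|M. f (r k) x) = (LINT x:space M - A|M. f (r k) x) + (LINT x:A|M. f (r k) x)"
          using A by (intro set_integral_Un set_integrable_bounded[OF meas bound]) auto
        moreover have "(space M - A) \<union> A = space M" using sets.sets_into_space[OF A] by auto
        ultimately show ?thesis by simp
      qed
      moreover have "convergent (\<lambda>k. LINT x:space M|M. f (r k) x)"
        using conv[OF gen(3)] by (auto simp: convergent_def)
      ultimately show ?case using compl.IH by (auto intro: convergent_diff)
    next
      case (union A)
      then have A: "range A \<subseteq> sets M" using gen(5) by simp
      have "\<exists>L. \<forall>i. (\<lambda>k. LINT x:A i|M. f (r k) x) \<longlonglongrightarrow> L i"
        using union.IH unfolding convergent_def by (intro choice) auto
      then obtain L where L: "\<And>i. (\<lambda>k. LINT x:A i|M. f (r k) x) \<longlonglongrightarrow> L i" by blast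
      show ?case
        using tendsto_set_integral_disjoint_UN(1)[OF meas bound A union.hyps(1) L]
        by (auto simp: convergent_def)
    qed
  qed
qed

text \<open>Since the \<open>f k\<close> are nonnegative, the setwise limit \<open>L\<close> is a
  genuine measure, and the upper bound gives \<open>L A \<le> C * measure M A\<close>. This
  inequality yields both absolute continuity, hence a Radon-Nikodym density, and the bound
  \<open>C\<close> on that density.\<close>

lemma (in finite_measure) setwise_limit_density:
  fixes f :: "nat \<Rightarrow> 'a \<Rightarrow> real"
  assumes meas: "\<And>k. f k \<in> borel_measurable M"
    and bound: "\<And>k. AE x in M. 0 \<le> f k x \<and> f k x \<le> C"
    and L: "\<And>A. A \<in> sets M \<Longrightarrow> (\<lambda>k. LINT x:A|M. f k x) \<longlonglongrightarrow> L A"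
  obtains g where "g \<in> borel_measurable M" "AE x in M. 0 \<le> g x \<and> g x \<le> C"
    "\<And>A. A \<in> sets M \<Longrightarrow> (LINT x:A|M. g x) = L A"
proof -
  have bound': "AE x in M. \<bar>f k x\<bar> \<le> C" for k
    using bound[of k] by eventually_elim auto
  have L_le: "L A \<le> C * measure M A" if "A \<in> sets M" for A
    using set_integral_bounded_le[OF meas bound' that]
    by (intro LIMSEQ_le_const2[OF L[OF that]]) (auto simp: abs_le_iff)
  have L_nonneg: "0 \<le> L A" if "A \<in> sets M" for A
  proof (rule LIMSEQ_le_const[OF L[OF that]], intro exI allI impI)
    fix k
    show "0 \<le> (LINT x:A|M. f k x)"
      using bound[of k] unfolding set_lebesgue_integral_def
      by (intro integral_nonneg_AE) (auto elim!: eventually_mono)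
  qed
  define N where "N = measure_of (space M) (sets M) (\<lambda>A. ennreal (L A))"
  have [simp]: "sets N = sets M" "space N = space M" by (auto simp: N_def)
  have emeasure_N: "emeasure N A = ennreal (L A)" if "A \<in> sets M" for A
    unfolding N_def
  proof (rule emeasure_measure_of_sigma)
    show "sigma_algebra (space M) (sets M)" ..
    \<comment> \<open>Squeezed between 0 and \<open>C * measure M {}\<close>.\<close>
    have "L {} = 0"
      using L_le[of "{}"] L_nonneg[of "{}"] by simp
    then show "positive (sets M) (\<lambda>A. ennreal (L A))"
      by (simp add: positive_def)
    show "countably_additive (sets M) (\<lambda>A. ennreal (L A))"
    proof (rule countably_additiveI)
      fix A :: "nat \<Rightarrow> 'a set"
      assume A: "range A \<subseteq> sets M" "disjoint_family A" "(\<Union>i. A i) \<in> sets M"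
      then have Ai: "A i \<in> sets M" for i by auto
      note * = tendsto_set_integral_disjoint_UN[OF meas bound' A(1,2) L[OF Ai]]
      have "L (\<Union>i. A i) = (\<Sum>i. L (A i))"
        using *(1) L[OF A(3)] LIMSEQ_unique by blast
      then show "(\<Sum>i. ennreal (L (A i))) = ennreal (L (\<Union>i. A i))"
        using *(2) L_nonneg[OF Ai] by (simp add: suminf_ennreal2)
    qed
  qed fact
  have "finite_measure N"
    by (rule finite_measureI) (simp add: emeasure_N)
  moreover have "absolutely_continuous M N"
    unfolding absolutely_continuous_def
  proof
    fix A assume A: "A \<in> null_sets M"
    then have "A \<in> sets M" "measure M A = 0" by (auto simp: measure_def)
    then show "A \<in> null_sets N"
      using L_le[of A] by (auto simp: null_sets_def emeasure_N ennreal_neg)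
  qed
  ultimately obtain h where h: "h \<in> borel_measurable M" "density M h = N"
    using Radon_Nikodym_finite_measure[of N] by auto
  \<comment> \<open>As \<open>N\<close> is finite, \<open>h\<close> is infinite only on a null set,
    so the real-valued version is still a density of \<open>N\<close>.\<close>
  define g where "g x = enn2real (h x)" for x
  have g: "g \<in> borel_measurable M" unfolding g_def using h by measurable
  have g_nonneg: "0 \<le> g x" for x by (simp add: g_def)
  have nn: "(\<integral>\<^sup>+ x\<in>A. h x \<partial>M) = ennreal (L A)" if "A \<in> sets M" for A
    using emeasure_density[OF h(1) that] emeasure_N[OF that] h(2) by simp
  have "(\<integral>\<^sup>+ x. h x \<partial>M) \<noteq> \<infinity>"
    using nn[OF sets.top] by (simp add: nn_integral_set_ennreal[symmetric] cong: nn_integral_cong)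
  then have "AE x in M. h x \<noteq> \<infinity>"
    using h(1) by (intro nn_integral_PInf_AE)
  then have hg: "AE x in M. ennreal (g x) = h x"
    unfolding g_def by eventually_elim (simp add: less_top)
  have gA: "set_integrable M A g" "(LINT x:A|M. g x) = L A" if A: "A \<in> sets M" for A
  proof -
    have "(\<integral>\<^sup>+ x. ennreal (indicator A x * g x) \<partial>M) = (\<integral>\<^sup>+ x\<in>A. h x \<partial>M)"
      using hg by (intro nn_integral_cong_AE) (auto elim!: eventually_mono split: split_indicator)
    also have "\<dots> = ennreal (L A)" by (rule nn[OF A])
    finally have "has_bochner_integral M (\<lambda>x. indicator A x * g x) (L A)"
      using A g L_nonneg[OF A] by (intro has_bochner_integral_nn_integral) (auto simp: g_def[symmetric] g_nonneg)
    then show "set_integrable M A g" "(LINT x:A|M. g x) = L A"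
      by (auto simp: set_integrable_def set_lebesgue_integral_def has_bochner_integral_iff)
  qed
  \<comment> \<open>The upper bound on \<open>g\<close> is read off from set integrals: an
    integrable function with nonnegative integral over every measurable set is nonnegative almost
    everywhere.\<close>
  have "integrable M (\<lambda>x. C - g x)"
    using gA(1)[OF sets.top] by (auto simp: set_integrable_def cong: Bochner_Integration.integrable_cong)
  moreover have "0 \<le> (LINT x:A|M. C - g x)" if A: "A \<in> sets M" for A
  proof -
    have "(LINT x:A|M. C - g x) = (LINT x:A|M. C) - (LINT x:A|M. g x)"
      using A by (intro set_integral_diff gA) (auto simp: set_integrable_def emeasure_eq_measure)
    then show ?thesis
      using L_le[OF A] A by (simp add: gA set_integral_const mult.commute)
  qed
  ultimately have "AE x in M. 0 \<le> C - g x"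
    by (rule density_nonneg)
  then have "AE x in M. 0 \<le> g x \<and> g x \<le> C"
    by eventually_elim (simp add: g_def)
  from g this gA(2) show ?thesis by (rule that)
qed

text \<open>Induction over integrable \<open>\<phi>\<close>: the hypothesis covers indicators,
  linearity covers sums, and the uniform bound \<open>C\<close> allows the passage to limits in L^1
  by an \<open>e / 3\<close> argument.\<close>

lemma (in finite_measure) tendsto_integral_mult_of_setwise:
  fixes f :: "nat \<Rightarrow> 'a \<Rightarrow> real"
  assumes f: "\<And>k. f k \<in> borel_measurable M" "\<And>k. AE x in M. \<bar>f k x\<bar> \<le> C"
    and g: "g \<in> borel_measurable M" "AE x in M. \<bar>g x\<bar> \<le> C"
    and setwise: "\<And>A. A \<in> sets M \<Longrightarrow> (\<lambda>k. LINT x:A|M. f k x) \<longlonglongrightarrow> (LINT x:A|M. g x)"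
    and "integrable M \<phi>"
  shows "(\<lambda>k. \<integral>x. f k x * \<phi> x \<partial>M) \<longlonglongrightarrow> (\<integral>x. g x * \<phi> x \<partial>M)"
  using \<open>integrable M \<phi>\<close>
proof induction
  case (base A c)
  have "(\<lambda>k. (LINT x:A|M. f k x) * c) \<longlonglongrightarrow> (LINT x:A|M. g x) * c"
    by (intro tendsto_mult_right setwise base)
  moreover have "(LINT x:A|M. h x) * c = (\<integral>x. h x * (indicat_real A x *\<^sub>R c) \<partial>M)" for h
    unfolding set_lebesgue_integral_def
    by (subst integral_mult_left_zero[symmetric]) (simp add: ac_simps)
  ultimately show ?case by simp
next
  case (add \<phi> \<psi>)
  have "(\<integral>x. h x * (\<phi> x + \<psi> x) \<partial>M) = (\<integral>x. h x * \<phi> x \<partial>M) + (\<integral>x. h x * \<psi> x \<partial>M)"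
    if "h \<in> borel_measurable M" "AE x in M. \<bar>h x\<bar> \<le> C" for h
    using add integrable_bounded_mult[OF that] by (simp add: distrib_left)
  then show ?case
    using tendsto_add[OF add.IH] f g by simp
next
  case (lim \<phi> s)
  \<comment> \<open>Replacing \<open>\<phi>\<close> by its approximation costs the same amount for
    every \<open>f k\<close> and for \<open>g\<close>, since only the common bound on
    \<open>h\<close> enters.\<close>
  have diff: "\<bar>(\<integral>x. h x * \<phi> x \<partial>M) - (\<integral>x. h x * s i x \<partial>M)\<bar> \<le> \<bar>C\<bar> * (\<integral>x. \<bar>\<phi> x - s i x\<bar> \<partial>M)"
    if h: "h \<in> borel_measurable M" "AE x in M. \<bar>h x\<bar> \<le> C" for h i
  proof -
    have i: "integrable M (\<lambda>x. h x * \<phi> x)" "integrable M (\<lambda>x. h x * s i x)"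
      using lim by (auto intro!: integrable_bounded_mult h)
    then have "\<bar>(\<integral>x. h x * \<phi> x \<partial>M) - (\<integral>x. h x * s i x \<partial>M)\<bar> = \<bar>\<integral>x. h x * \<phi> x - h x * s i x \<partial>M\<bar>"
      by simp
    also have "\<dots> \<le> (\<integral>x. \<bar>C\<bar> * \<bar>\<phi> x - s i x\<bar> \<partial>M)"
    proof (rule order_trans[OF integral_abs_bound], rule integral_mono_AE)
      show "AE x in M. \<bar>h x * \<phi> x - h x * s i x\<bar> \<le> \<bar>C\<bar> * \<bar>\<phi> x - s i x\<bar>"
        using h(2)
        by eventually_elim (auto simp: abs_mult right_diff_distrib[symmetric] intro!: mult_right_mono)
    qed (use i lim in auto)
    finally show ?thesis by simp
  qed
  have "(\<lambda>i. \<integral>x. \<bar>\<phi> x - s i x\<bar> \<partial>M) \<longlonglongrightarrow> (\<integral>x. 0 \<partial>M)"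
  \<comment> \<open>The approximations in the induction satisfy
    \<open>norm (s i x) \<le> 2 * norm (\<phi> x)\<close>, so the triangle inequality gives the
    factor 3.\<close>
  proof (rule integral_dominated_convergence[where w = "\<lambda>x. 3 * \<bar>\<phi> x\<bar>"])
    show "AE x in M. (\<lambda>i. \<bar>\<phi> x - s i x\<bar>) \<longlonglongrightarrow> 0"
    proof (rule AE_I2)
      fix x assume "x \<in> space M"
      from tendsto_diff[OF tendsto_const[of "\<phi> x"] lim.hyps(2)[OF this]]
      show "(\<lambda>i. \<bar>\<phi> x - s i x\<bar>) \<longlonglongrightarrow> 0"
        by (intro tendsto_rabs_zero) simp
    qed
    show "AE x in M. norm \<bar>\<phi> x - s i x\<bar> \<le> 3 * \<bar>\<phi> x\<bar>" for i
    proof (rule AE_I2)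
      fix x assume "x \<in> space M"
      from lim.hyps(3)[OF this, of i] show "norm \<bar>\<phi> x - s i x\<bar> \<le> 3 * \<bar>\<phi> x\<bar>" by simp
    qed
  qed (use lim in auto)
  from tendsto_mult_left[OF this, of "\<bar>C\<bar>"]
  have zero: "(\<lambda>i. \<bar>C\<bar> * (\<integral>x. \<bar>\<phi> x - s i x\<bar> \<partial>M)) \<longlonglongrightarrow> 0" by simp
  show ?case
  proof (rule LIMSEQ_I)
    fix e :: real assume "0 < e"
    then obtain i where i: "\<bar>C\<bar> * (\<integral>x. \<bar>\<phi> x - s i x\<bar> \<partial>M) < e / 3"
      using order_tendstoD(2)[OF zero, of "e / 3"] by (auto dest: eventually_happens)
    obtain n where n: "\<And>k. k \<ge> n \<Longrightarrow> \<bar>(\<integral>x. f k x * s i x \<partial>M) - (\<integral>x. g x * s i x \<partial>M)\<bar> < e / 3"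
      using LIMSEQ_D[OF lim.IH[of i], of "e / 3"] \<open>0 < e\<close> by auto
    show "\<exists>n. \<forall>k\<ge>n. norm ((\<integral>x. f k x * \<phi> x \<partial>M) - (\<integral>x. g x * \<phi> x \<partial>M)) < e"
    proof (intro exI allI impI)
      fix k assume "n \<le> k"
      from n[OF this] i diff[OF f(1)[of k] f(2)[of k], of i] diff[OF g, of i]
      show "norm ((\<integral>x. f k x * \<phi> x \<partial>M) - (\<integral>x. g x * \<phi> x \<partial>M)) < e"
        unfolding real_norm_def by linarith
    qed
  qed
qed

section \<open>Weak* sequential compactness of bounded sets in L^infinity\<close>

text \<open>Adding \<open>C\<close> makes the functions nonnegative with bound \<open>2 * C\<close>,
  so that the setwise limit is a measure rather than a signed one. The shift is removed from the
  limit density at the end.\<close>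

lemma weak_star_convergent_subsequence:
  fixes M :: "'a::second_countable_topology measure" and f :: "nat \<Rightarrow> 'a \<Rightarrow> real"
  assumes "finite_measure M" "sets M = sets borel"
    and meas: "\<And>k. f k \<in> borel_measurable M" and bound: "\<And>k. AE x in M. \<bar>f k x\<bar> \<le> C"
  obtains r g where "strict_mono (r::nat \<Rightarrow> nat)" "weak_star_converges M (\<lambda>k. f (r k)) g"
proof -
  interpret finite_measure M by fact
  have [simp]: "space M = UNIV" using sets_eq_imp_space_eq[OF assms(2)] by simp
  obtain G :: "'a set set" where G: "countable G" "Int_stable G" "UNIV \<in> G" "sets borel = sigma_sets UNIV G"
    by (rule countable_Int_stable_generator_borel)
  define h where "h k x = f k x + C" for k x
  have h_meas: "h k \<in> borel_measurable M" for k unfolding h_def using meas by measurable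
  have h_bound: "AE x in M. 0 \<le> h k x \<and> h k x \<le> 2 * C" for k
    using bound[of k] by eventually_elim (auto simp: h_def)
  have h_bound': "AE x in M. \<bar>h k x\<bar> \<le> 2 * C" for k
    using h_bound[of k] by eventually_elim auto
  obtain r :: "nat \<Rightarrow> nat" where r: "strict_mono r"
    and conv: "\<And>A. A \<in> sets M \<Longrightarrow> convergent (\<lambda>k. LINT x:A|M. h (r k) x)"
    using setwise_convergent_subsequence[of G h "2 * C"] G assms(2) h_meas h_bound' by auto
  obtain g where g: "g \<in> borel_measurable M" "AE x in M. 0 \<le> g x \<and> g x \<le> 2 * C"
    and gA: "\<And>A. A \<in> sets M \<Longrightarrow> (LINT x:A|M. g x) = lim (\<lambda>k. LINT x:A|M. h (r k) x)"
    using setwise_limit_density[of "\<lambda>k. h (r k)", OF h_meas h_bound conv[unfolded convergent_LIMSEQ_iff]]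
    by blast
  have g': "AE x in M. \<bar>g x\<bar> \<le> 2 * C" using g(2) by eventually_elim auto
  have tends: "(\<lambda>k. \<integral>x. h (r k) x * \<phi> x \<partial>M) \<longlonglongrightarrow> (\<integral>x. g x * \<phi> x \<partial>M)" if "integrable M \<phi>" for \<phi>
    using that conv
    by (intro tendsto_integral_mult_of_setwise[OF h_meas h_bound' g(1) g'])
      (auto simp: gA convergent_LIMSEQ_iff)
  have "weak_star_converges M (\<lambda>k. f (r k)) (\<lambda>x. g x - C)"
    unfolding weak_star_converges_def
  proof (intro conjI allI impI)
    show "f (r k) \<in> Linfty M" for k using meas bound by (auto simp: Linfty_def)
    show "(\<lambda>x. g x - C) \<in> Linfty M"
    proof -
      have "AE x in M. \<bar>g x - C\<bar> \<le> C"
        using g(2) by eventually_elim auto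
      with g(1) show ?thesis by (auto simp: Linfty_def)
    qed
    fix \<phi> :: "'a \<Rightarrow> real" assume \<phi>: "integrable M \<phi>"
    have "(\<lambda>k. (\<integral>x. h (r k) x * \<phi> x \<partial>M) - C * (\<integral>x. \<phi> x \<partial>M)) \<longlonglongrightarrow> (\<integral>x. g x * \<phi> x \<partial>M) - C * (\<integral>x. \<phi> x \<partial>M)"
      by (intro tendsto_diff tends \<phi> tendsto_const)
    \<comment> \<open>Stated for a general \<open>w\<close>, so that it undoes the shift both along
      the sequence, with \<open>h (r k)\<close>, and in the limit, with \<open>g\<close>.\<close>
    moreover have shift: "(\<integral>x. (w x - C) * \<phi> x \<partial>M) = (\<integral>x. w x * \<phi> x \<partial>M) - C * (\<integral>x. \<phi> x \<partial>M)"
      if "w \<in> borel_measurable M" "AE x in M. \<bar>w x\<bar> \<le> 2 * C" for w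
      using integrable_bounded_mult[OF that \<phi>] \<phi> by (simp add: left_diff_distrib)
    moreover have "(\<integral>x. f (r k) x * \<phi> x \<partial>M) = (\<integral>x. h (r k) x * \<phi> x \<partial>M) - C * (\<integral>x. \<phi> x \<partial>M)" for k
      using shift[OF h_meas h_bound'[of "r k"]] by (simp add: h_def)
    ultimately show "(\<lambda>k. \<integral>x. f (r k) x * \<phi> x \<partial>M) \<longlonglongrightarrow> (\<integral>x. (g x - C) * \<phi> x \<partial>M)"
      by (simp only: shift[OF g(1) g'])
  qed
  with r show ?thesis by (rule that)
qed

section \<open>Bounded functions and weak* convergence on a product space\<close>

lemma (in finite_measure) integrable_Linfty:
  assumes "f \<in> Linfty M"
  shows "integrable M f"
  using assms integrable_const_bound[of f] by (auto simp: Linfty_def)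

lemma (in finite_measure) integrable_Linfty_mult:
  fixes g :: "'a \<Rightarrow> real"
  assumes "f \<in> Linfty M" "integrable M g"
  shows "integrable M (\<lambda>x. f x * g x)"
  using assms integrable_bounded_mult[of f] by (auto simp: Linfty_def)

context pair_prob_space
begin

lemma Linfty_fst:
  assumes "f \<in> Linfty M1"
  shows "(\<lambda>z. f (fst z)) \<in> Linfty (M1 \<Otimes>\<^sub>M M2)"
proof -
  from assms obtain C where [measurable]: "f \<in> borel_measurable M1" and C: "AE x in M1. \<bar>f x\<bar> \<le> C"
    by (auto simp: Linfty_def)
  have "AE z in M1 \<Otimes>\<^sub>M M2. \<bar>f (fst z)\<bar> \<le> C"
  proof (rule AE_pair_measure)
    show "AE x in M1. AE y in M2. \<bar>f (fst (x, y))\<bar> \<le> C"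
      using C by eventually_elim simp
  qed measurable
  then show ?thesis by (auto simp: Linfty_def)
qed

lemma Linfty_snd:
  assumes "f \<in> Linfty M2"
  shows "(\<lambda>z. f (snd z)) \<in> Linfty (M1 \<Otimes>\<^sub>M M2)"
proof -
  from assms obtain C where [measurable]: "f \<in> borel_measurable M2" and C: "AE y in M2. \<bar>f y\<bar> \<le> C"
    by (auto simp: Linfty_def)
  have "AE z in M1 \<Otimes>\<^sub>M M2. \<bar>f (snd z)\<bar> \<le> C"
  proof (rule AE_pair_measure)
    show "AE x in M1. AE y in M2. \<bar>f (snd (x, y))\<bar> \<le> C"
      using C by simp
  qed measurable
  then show ?thesis by (auto simp: Linfty_def)
qed

lemma integral_mult_fst:
  assumes "f \<in> Linfty M1" and \<psi>: "integrable (M1 \<Otimes>\<^sub>M M2) \<psi>"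
  shows "(\<integral>z. f (fst z) * \<psi> z \<partial>(M1 \<Otimes>\<^sub>M M2)) = (\<integral>x. f x * (\<integral>y. \<psi> (x, y) \<partial>M2) \<partial>M1)"
proof -
  have "integrable (M1 \<Otimes>\<^sub>M M2) (\<lambda>z. f (fst z) * \<psi> z)"
    by (rule P.integrable_Linfty_mult[OF Linfty_fst[OF assms(1)] \<psi>])
  from integral_fst'[OF this] show ?thesis by simp
qed

lemma integral_mult_snd:
  assumes "f \<in> Linfty M2" and \<psi>: "integrable (M1 \<Otimes>\<^sub>M M2) \<psi>"
  shows "(\<integral>z. f (snd z) * \<psi> z \<partial>(M1 \<Otimes>\<^sub>M M2)) = (\<integral>y. f y * (\<integral>x. \<psi> (x, y) \<partial>M1) \<partial>M2)"
proof -
  have "integrable (M1 \<Otimes>\<^sub>M M2) (\<lambda>z. f (snd z) * \<psi> z)"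
    by (rule P.integrable_Linfty_mult[OF Linfty_snd[OF assms(1)] \<psi>])
  then have "integrable (M1 \<Otimes>\<^sub>M M2) (case_prod (\<lambda>x y. f y * \<psi> (x, y)))"
    by (simp add: case_prod_unfold)
  from integral_snd[OF this] show ?thesis by (simp add: case_prod_unfold)
qed

text \<open>By Fubini, testing against \<open>\<psi>\<close> on the product amounts to testing
  \<open>f k\<close> against the partial integral of \<open>\<psi>\<close>, which is integrable on
  the first factor. Thus indicators of all product-measurable sets, and not only of rectangles,
  become admissible test functions.\<close>

lemma weak_star_converges_fst:
  assumes "weak_star_converges M1 f g"
  shows "weak_star_converges (M1 \<Otimes>\<^sub>M M2) (\<lambda>k z. f k (fst z)) (\<lambda>z. g (fst z))"
  unfolding weak_star_converges_def
proof (intro conjI allI impI)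
  fix \<psi> :: "'a \<times> 'b \<Rightarrow> real" assume \<psi>: "integrable (M1 \<Otimes>\<^sub>M M2) \<psi>"
  then have "integrable M1 (\<lambda>x. \<integral>y. \<psi> (x, y) \<partial>M2)"
    by (rule integrable_fst')
  with \<psi> assms show "(\<lambda>k. \<integral>z. f k (fst z) * \<psi> z \<partial>(M1 \<Otimes>\<^sub>M M2)) \<longlonglongrightarrow> (\<integral>z. g (fst z) * \<psi> z \<partial>(M1 \<Otimes>\<^sub>M M2))"
    by (simp add: weak_star_converges_def integral_mult_fst)
qed (use assms in \<open>auto simp: weak_star_converges_def intro: Linfty_fst\<close>)

lemma weak_star_converges_snd:
  assumes "weak_star_converges M2 f g"
  shows "weak_star_converges (M1 \<Otimes>\<^sub>M M2) (\<lambda>k z. f k (snd z)) (\<lambda>z. g (snd z))"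
  unfolding weak_star_converges_def
proof (intro conjI allI impI)
  fix \<psi> :: "'a \<times> 'b \<Rightarrow> real" assume \<psi>: "integrable (M1 \<Otimes>\<^sub>M M2) \<psi>"
  then have "integrable M2 (\<lambda>y. \<integral>x. \<psi> (x, y) \<partial>M1)"
    using integrable_snd[of "\<lambda>x y. \<psi> (x, y)"] by simp
  with \<psi> assms show "(\<lambda>k. \<integral>z. f k (snd z) * \<psi> z \<partial>(M1 \<Otimes>\<^sub>M M2)) \<longlonglongrightarrow> (\<integral>z. g (snd z) * \<psi> z \<partial>(M1 \<Otimes>\<^sub>M M2))"
    by (simp add: weak_star_converges_def integral_mult_snd)
qed (use assms in \<open>auto simp: weak_star_converges_def intro: Linfty_snd\<close>)

end

section \<open>The cost function and the exponential penalty\<close>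

lemma borel_measurable_lower_semicontinuous:
  fixes c :: "'a::topological_space \<Rightarrow> ennreal"
  assumes "lower_semicontinuous c"
  shows "c \<in> borel_measurable borel"
  using assms by (intro borel_measurableI_greater) (auto simp: lower_semicontinuous_def)

text \<open>Reduces the extended exponent to a real one. At infinite cost the quotient is -infinity
  because \<open>\<epsilon>\<close> is positive, and \<open>exp_ext\<close> sends it to 0.\<close>

lemma exp_ext_entropic:
  assumes "0 < \<epsilon>"
  shows "exp_ext ((ereal a - enn2ereal d) / ereal \<epsilon>)
    = (if d = \<infinity> then 0 else ennreal (exp ((a - enn2real d) / \<epsilon>)))"
proof (cases d)
  case (real r)
  then show ?thesis using assms by (simp add: exp_ext_def)
next
  case top
  then show ?thesis using assms by (simp add: exp_ext_def)
qed

text \<open>The exponential integral of \<open>entropic_dual\<close> on its own, without the factor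
  \<open>\<epsilon>\<close>; its finiteness decides whether the dual value is real or
  -infinity.\<close>

definition entropic_penalty ::
  "'a measure \<Rightarrow> 'b measure \<Rightarrow> ('a \<times> 'b \<Rightarrow> ennreal) \<Rightarrow> real \<Rightarrow> ('a \<Rightarrow> real) \<Rightarrow> ('b \<Rightarrow> real) \<Rightarrow> ennreal"
where
  "entropic_penalty \<mu> \<nu> c \<epsilon> u v =
     (\<integral>\<^sup>+ (x, y). exp_ext ((ereal (u x + v y) - enn2ereal (c (x, y))) / ereal \<epsilon>) \<partial>(\<mu> \<Otimes>\<^sub>M \<nu>))"

lemma entropic_dual_eq_real:
  assumes "entropic_penalty \<mu> \<nu> c \<epsilon> u v \<noteq> \<infinity>"
  shows "entropic_dual \<mu> \<nu> c \<epsilon> u v = ereal ((\<integral>x. u x \<partial>\<mu>) + (\<integral>y. v y \<partial>\<nu>)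
    - \<epsilon> * enn2real (entropic_penalty \<mu> \<nu> c \<epsilon> u v) + \<epsilon>)"
  using assms unfolding entropic_dual_def entropic_penalty_def[symmetric]
  by (cases "entropic_penalty \<mu> \<nu> c \<epsilon> u v") auto

lemma entropic_dual_eq_MInfty:
  assumes "entropic_penalty \<mu> \<nu> c \<epsilon> u v = \<infinity>" "0 < \<epsilon>"
  shows "entropic_dual \<mu> \<nu> c \<epsilon> u v = -\<infinity>"
  using assms unfolding entropic_dual_def entropic_penalty_def[symmetric] by simp

section \<open>Optimality estimates and feasibility of the limit\<close>

context pair_prob_space
begin

text \<open>Under the constraint the exponent is nonpositive almost everywhere, so the exponential
  integral against a probability measure is at most 1, and the summand \<open>\<epsilon>\<close> in
  the dual functional compensates the penalty.\<close>

lemma dual_feasible_le_entropic_dual: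
  assumes "(u, v) \<in> dual_feasible M1 M2 c" "0 < \<epsilon>"
  shows "ereal ((\<integral>x. u x \<partial>M1) + (\<integral>y. v y \<partial>M2)) \<le> entropic_dual M1 M2 c \<epsilon> u v"
proof -
  have "AE z in M1 \<Otimes>\<^sub>M M2. ereal (u (fst z) + v (snd z)) \<le> enn2ereal (c z)"
    using assms(1) by (simp add: dual_feasible_def case_prod_beta)
  then have "AE z in M1 \<Otimes>\<^sub>M M2. exp_ext ((ereal (u (fst z) + v (snd z)) - enn2ereal (c z)) / ereal \<epsilon>) \<le> 1"
  proof eventually_elim
    case (elim z)
    then show ?case
      unfolding exp_ext_entropic[OF assms(2)] using assms(2)
      by (cases "c z") (auto simp: divide_le_0_iff)
  qed
  then have "entropic_penalty M1 M2 c \<epsilon> u v \<le> (\<integral>\<^sup>+ z. 1 \<partial>(M1 \<Otimes>\<^sub>M M2))"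
    unfolding entropic_penalty_def by (intro nn_integral_mono_AE) (simp add: case_prod_beta)
  then have E: "entropic_penalty M1 M2 c \<epsilon> u v \<le> 1"
    by (simp add: P.emeasure_space_1)
  then have "enn2real (entropic_penalty M1 M2 c \<epsilon> u v) \<le> 1" "entropic_penalty M1 M2 c \<epsilon> u v \<noteq> \<infinity>"
    by (auto simp: enn2real_leI top_unique)
  then show ?thesis
    using assms(2) by (simp add: entropic_dual_eq_real mult_le_cancel_left1)
qed

text \<open>Replacing \<open>u\<close> by \<open>u - \<epsilon>\<close> divides the penalty by \<open>exp 1\<close>, so optimality bounds it.\<close>

lemma entropic_maximizer_penalty_le:
  assumes [measurable]: "c \<in> borel_measurable (M1 \<Otimes>\<^sub>M M2)" and "0 < \<epsilon>"
    and max: "entropic_maximizer M1 M2 c \<epsilon> u v"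
  shows "entropic_penalty M1 M2 c \<epsilon> u v \<le> 2"
proof -
  from max have int: "integrable M1 u" "integrable M2 v"
    by (auto simp: entropic_maximizer_def is_arg_max_def)
  from int have [measurable]: "u \<in> borel_measurable M1" "v \<in> borel_measurable M2" by auto
  have opt: "entropic_dual M1 M2 c \<epsilon> u' v' \<le> entropic_dual M1 M2 c \<epsilon> u v"
    if "integrable M1 u'" "integrable M2 v'" for u' v'
    using max that by (auto simp: entropic_maximizer_def is_arg_max_def not_less)
  let ?E = "entropic_penalty M1 M2 c \<epsilon> u v"
  \<comment> \<open>The zero pair is feasible because the cost is nonnegative. It forces the optimal
    value to be nonnegative, which rules out an infinite penalty.\<close>
  have "((\<lambda>_. 0), (\<lambda>_. 0)) \<in> dual_feasible M1 M2 c"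
    by (simp add: dual_feasible_def case_prod_beta zero_ereal_def[symmetric])
  from dual_feasible_le_entropic_dual[OF this \<open>0 < \<epsilon>\<close>] opt[of "\<lambda>_. 0" "\<lambda>_. 0"]
  have "0 \<le> entropic_dual M1 M2 c \<epsilon> u v" by (auto simp: zero_ereal_def intro: order_trans)
  with entropic_dual_eq_MInfty[of M1 M2 c \<epsilon> u v] \<open>0 < \<epsilon>\<close> have fin: "?E \<noteq> \<infinity>" by auto
  have "(a - \<epsilon> + b - t) / \<epsilon> = -1 + (a + b - t) / \<epsilon>" for a b t :: real
    using \<open>0 < \<epsilon>\<close> by (simp add: field_simps)
  then have "entropic_penalty M1 M2 c \<epsilon> (\<lambda>x. u x - \<epsilon>) v = ennreal (exp (-1)) * ?E"
    unfolding entropic_penalty_def exp_ext_entropic[OF \<open>0 < \<epsilon>\<close>] case_prod_beta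
    by (subst nn_integral_cmult[symmetric])
      (auto intro!: nn_integral_cong simp: ennreal_mult[symmetric] exp_add[symmetric])
  with fin have fin': "entropic_penalty M1 M2 c \<epsilon> (\<lambda>x. u x - \<epsilon>) v \<noteq> \<infinity>"
    and E': "enn2real (entropic_penalty M1 M2 c \<epsilon> (\<lambda>x. u x - \<epsilon>) v) = exp (-1) * enn2real ?E"
    by (auto simp: ennreal_mult_eq_top_iff enn2real_mult)
  \<comment> \<open>The competitor loses exactly \<open>\<epsilon>\<close> in the linear term, as
    \<open>M1\<close> has mass 1; by optimality its gain in the penalty cannot exceed this
    loss.\<close>
  have "(\<integral>x. u x - \<epsilon> \<partial>M1) = (\<integral>x. u x \<partial>M1) - \<epsilon>"
    using int by (simp add: M1.prob_space)
  with opt[of "\<lambda>x. u x - \<epsilon>" v] int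
  have "\<epsilon> * enn2real ?E - \<epsilon> * (exp (-1) * enn2real ?E) \<le> \<epsilon>"
    by (simp add: entropic_dual_eq_real[OF fin] entropic_dual_eq_real[OF fin'] E')
  then have "\<epsilon> * (enn2real ?E * (1 - exp (-1))) \<le> \<epsilon> * 1"
    by (simp add: algebra_simps)
  then have *: "enn2real ?E * (1 - exp (-1)) \<le> 1"
    using \<open>0 < \<epsilon>\<close> by simp
  \<comment> \<open>Hence \<open>1 - exp (-1)\<close> is at least 1/2, which is where the bound 2
    comes from.\<close>
  have "(2::real) \<le> exp 1" using exp_ge_add_one_self[of 1] by simp
  then have "exp (-1) \<le> (1 / 2 :: real)" by (simp add: exp_minus field_simps)
  then have "enn2real ?E * (1 / 2) \<le> enn2real ?E * (1 - exp (-1))"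
    by (intro mult_left_mono) auto
  with * have "enn2real ?E \<le> 2" by simp
  then have "ennreal (enn2real ?E) \<le> ennreal 2" by (rule ennreal_leI)
  with fin show ?thesis by (simp add: ennreal_enn2real less_top)
qed

text \<open>Use \<open>t \<le> exp t\<close> with \<open>t = ?w z / \<epsilon>\<close>. The
  exponential is positive off \<open>A\<close> as well, so its integral over the whole product, at
  most 2, controls the integral over every \<open>A\<close>.\<close>

lemma entropic_maximizer_set_integral_le:
  assumes c: "c \<in> borel_measurable (M1 \<Otimes>\<^sub>M M2)" "(\<integral>\<^sup>+ z. c z \<partial>(M1 \<Otimes>\<^sub>M M2)) \<noteq> \<infinity>"
    and "0 < \<epsilon>" and max: "entropic_maximizer M1 M2 c \<epsilon> u v" and A: "A \<in> sets (M1 \<Otimes>\<^sub>M M2)"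
    and w: "integrable (M1 \<Otimes>\<^sub>M M2) (\<lambda>z. u (fst z) + v (snd z) - enn2real (c z))"
  shows "(LINT z:A|M1 \<Otimes>\<^sub>M M2. u (fst z) + v (snd z) - enn2real (c z)) \<le> 2 * \<epsilon>"
proof -
  let ?w = "\<lambda>z. u (fst z) + v (snd z) - enn2real (c z)"
  have [measurable]: "?w \<in> borel_measurable (M1 \<Otimes>\<^sub>M M2)" using w by (rule borel_measurable_integrable)
  \<comment> \<open>\<open>enn2real\<close> turns infinite cost into 0, so the real integrand
    \<open>exp (?w z / \<epsilon>)\<close> agrees with the extended one only where the cost is
    finite.\<close>
  have "AE z in M1 \<Otimes>\<^sub>M M2. c z \<noteq> \<infinity>"
    using c by (rule nn_integral_PInf_AE)
  then have "(\<integral>\<^sup>+ z. ennreal (exp (?w z / \<epsilon>)) \<partial>(M1 \<Otimes>\<^sub>M M2)) = entropic_penalty M1 M2 c \<epsilon> u v"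
    unfolding entropic_penalty_def exp_ext_entropic[OF \<open>0 < \<epsilon>\<close>] case_prod_beta
    by (intro nn_integral_cong_AE) (auto elim!: eventually_mono)
  also have "\<dots> \<le> ennreal 2"
    using entropic_maximizer_penalty_le[OF c(1) \<open>0 < \<epsilon>\<close> max] by simp
  finally have E: "(\<integral>\<^sup>+ z. ennreal (exp (?w z / \<epsilon>)) \<partial>(M1 \<Otimes>\<^sub>M M2)) \<le> ennreal 2" .
  have int: "integrable (M1 \<Otimes>\<^sub>M M2) (\<lambda>z. exp (?w z / \<epsilon>))"
    using E by (intro integrableI_nonneg) (auto intro: le_less_trans)
  have E2: "(\<integral>z. exp (?w z / \<epsilon>) \<partial>(M1 \<Otimes>\<^sub>M M2)) \<le> 2"
    using E int by (simp add: nn_integral_eq_integral del: ennreal_numeral)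
  have "(LINT z:A|M1 \<Otimes>\<^sub>M M2. ?w z) \<le> (\<integral>z. \<epsilon> * exp (?w z / \<epsilon>) \<partial>(M1 \<Otimes>\<^sub>M M2))"
    unfolding set_lebesgue_integral_def
  proof (rule integral_mono)
    show "integrable (M1 \<Otimes>\<^sub>M M2) (\<lambda>z. indicat_real A z *\<^sub>R ?w z)"
      using A w by (rule integrable_mult_indicator)
    fix z
    have "?w z / \<epsilon> \<le> exp (?w z / \<epsilon>)"
      using exp_ge_add_one_self[of "?w z / \<epsilon>"] by linarith
    then have "?w z \<le> \<epsilon> * exp (?w z / \<epsilon>)"
      using \<open>0 < \<epsilon>\<close> by (simp add: divide_le_eq mult.commute)
    then show "indicat_real A z *\<^sub>R ?w z \<le> \<epsilon> * exp (?w z / \<epsilon>)"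
      using \<open>0 < \<epsilon>\<close> by (auto split: split_indicator)
  qed (use int in auto)
  also have "\<dots> \<le> 2 * \<epsilon>" using E2 \<open>0 < \<epsilon>\<close> by simp
  finally show ?thesis .
qed

text \<open>Almost everywhere inequalities are tested by integrals over all measurable sets
  \<open>A\<close> of the product. These integrals pass to the weak* limit, and the bound
  \<open>2 * e k\<close> on them tends to 0.\<close>

lemma weak_star_limit_entropic_maximizers_feasible:
  assumes c: "c \<in> borel_measurable (M1 \<Otimes>\<^sub>M M2)" "(\<integral>\<^sup>+ z. c z \<partial>(M1 \<Otimes>\<^sub>M M2)) \<noteq> \<infinity>"
    and e: "\<And>k. 0 < e k" "e \<longlonglongrightarrow> 0"
    and max: "\<And>k. entropic_maximizer M1 M2 c (e k) (u k) (v k)"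
    and u: "weak_star_converges M1 u u'" and v: "weak_star_converges M2 v v'"
  shows "(u', v') \<in> dual_feasible M1 M2 c"
proof -
  note U = weak_star_converges_fst[OF u] and V = weak_star_converges_snd[OF v]
  have c_fin: "AE z in M1 \<Otimes>\<^sub>M M2. c z \<noteq> \<infinity>"
    using c by (rule nn_integral_PInf_AE)
  have "(\<integral>\<^sup>+ z. ennreal (enn2real (c z)) \<partial>(M1 \<Otimes>\<^sub>M M2)) \<le> (\<integral>\<^sup>+ z. c z \<partial>(M1 \<Otimes>\<^sub>M M2))"
    by (intro nn_integral_mono) (simp add: ennreal_enn2real_if)
  then have c_int: "integrable (M1 \<Otimes>\<^sub>M M2) (\<lambda>z. enn2real (c z))"
    using c by (intro integrableI_nonneg) (auto simp: less_top intro: le_less_trans)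
  have u_int: "integrable (M1 \<Otimes>\<^sub>M M2) (\<lambda>z. u k (fst z))" "integrable (M1 \<Otimes>\<^sub>M M2) (\<lambda>z. u' (fst z))"
    and v_int: "integrable (M1 \<Otimes>\<^sub>M M2) (\<lambda>z. v k (snd z))" "integrable (M1 \<Otimes>\<^sub>M M2) (\<lambda>z. v' (snd z))" for k
    using U V by (auto simp: weak_star_converges_def intro: P.integrable_Linfty)
  have "0 \<le> (LINT z:A|M1 \<Otimes>\<^sub>M M2. enn2real (c z) - (u' (fst z) + v' (snd z)))"
    if A: "A \<in> sets (M1 \<Otimes>\<^sub>M M2)" for A
  proof -
    let ?w = "\<lambda>u v z. u (fst z) + v (snd z) - enn2real (c z)"
    have 1: "integrable (M1 \<Otimes>\<^sub>M M2) (indicat_real A)"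
      using A by (simp add: P.emeasure_eq_measure)
    \<comment> \<open>Isolates the two terms that depend on the potentials as pairings with the test
      function \<open>indicat_real A\<close>; the cost term is the same for all
      \<open>k\<close>.\<close>
    have split: "(LINT z:A|M1 \<Otimes>\<^sub>M M2. ?w f g z) = (\<integral>z. f (fst z) * indicat_real A z \<partial>(M1 \<Otimes>\<^sub>M M2))
        + (\<integral>z. g (snd z) * indicat_real A z \<partial>(M1 \<Otimes>\<^sub>M M2)) - (LINT z:A|M1 \<Otimes>\<^sub>M M2. enn2real (c z))"
      if "integrable (M1 \<Otimes>\<^sub>M M2) (\<lambda>z. f (fst z))" "integrable (M1 \<Otimes>\<^sub>M M2) (\<lambda>z. g (snd z))" for f g
      using that[THEN integrable_mult_indicator[OF A]] integrable_mult_indicator[OF A c_int]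
      by (simp add: set_lebesgue_integral_def algebra_simps)
    have "(\<lambda>k. LINT z:A|M1 \<Otimes>\<^sub>M M2. ?w (u k) (v k) z) \<longlonglongrightarrow> (LINT z:A|M1 \<Otimes>\<^sub>M M2. ?w u' v' z)"
      unfolding split[OF u_int(1) v_int(1)] split[OF u_int(2) v_int(2)]
      using U V 1 by (intro tendsto_intros) (auto simp: weak_star_converges_def)
    moreover have "(\<lambda>k. 2 * e k) \<longlonglongrightarrow> 0"
      using tendsto_mult_left[OF e(2), of 2] by simp
    ultimately have "(LINT z:A|M1 \<Otimes>\<^sub>M M2. ?w u' v' z) \<le> 0"
    proof (rule LIMSEQ_le, intro exI allI impI)
      show "(LINT z:A|M1 \<Otimes>\<^sub>M M2. ?w (u k) (v k) z) \<le> 2 * e k" for k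
        using u_int v_int c_int
        by (intro entropic_maximizer_set_integral_le[OF c e(1) max A]) auto
    qed
    moreover have "(LINT z:A|M1 \<Otimes>\<^sub>M M2. enn2real (c z) - (u' (fst z) + v' (snd z)))
        = - (LINT z:A|M1 \<Otimes>\<^sub>M M2. ?w u' v' z)"
      unfolding set_lebesgue_integral_def by (subst integral_minus[symmetric]) (simp add: algebra_simps)
    ultimately show ?thesis by simp
  qed
  then have "AE z in M1 \<Otimes>\<^sub>M M2. 0 \<le> enn2real (c z) - (u' (fst z) + v' (snd z))"
    using u_int v_int c_int by (intro density_nonneg) auto
  with c_fin have "AE z in M1 \<Otimes>\<^sub>M M2. ereal (u' (fst z) + v' (snd z)) \<le> enn2ereal (c z)"
  proof eventually_elim
    case (elim z)
    then show ?case by (cases "c z") auto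
  qed
  moreover have "integrable M1 u'" "integrable M2 v'"
    using u v by (auto simp: weak_star_converges_def intro: M1.integrable_Linfty M2.integrable_Linfty)
  ultimately show ?thesis by (simp add: dual_feasible_def case_prod_beta)
qed

end

section \<open>Extraction of the sequence and passage to the limit\<close>

lemma weak_star_converges_subseq:
  assumes "weak_star_converges M f g" "strict_mono (r :: nat \<Rightarrow> nat)"
  shows "weak_star_converges M (\<lambda>k. f (r k)) g"
  unfolding weak_star_converges_def
proof (intro conjI allI impI)
  fix \<phi> :: "'a \<Rightarrow> real" assume "integrable M \<phi>"
  with assms(1) have "(\<lambda>k. \<integral>x. f k x * \<phi> x \<partial>M) \<longlonglongrightarrow> (\<integral>x. g x * \<phi> x \<partial>M)"
    by (simp add: weak_star_converges_def)
  from LIMSEQ_subseq_LIMSEQ[OF this assms(2)]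
  show "(\<lambda>k. \<integral>x. f (r k) x * \<phi> x \<partial>M) \<longlonglongrightarrow> (\<integral>x. g x * \<phi> x \<partial>M)"
    by (simp add: o_def)
qed (use assms(1) in \<open>auto simp: weak_star_converges_def\<close>)

lemma (in prob_space) weak_star_converges_integral:
  assumes "weak_star_converges M f g"
  shows "(\<lambda>k. \<integral>x. f k x \<partial>M) \<longlonglongrightarrow> (\<integral>x. g x \<partial>M)"
proof -
  have "integrable M (\<lambda>_. 1 :: real)" by simp
  with assms have "(\<lambda>k. \<integral>x. f k x * 1 \<partial>M) \<longlonglongrightarrow> (\<integral>x. g x * 1 \<partial>M)"
    unfolding weak_star_converges_def by blast
  then show ?thesis by simp
qed

theorem proposition4p1:
  fixes \<mu> :: "'a::polish_space measure" and \<nu> :: "'b::polish_space measure"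
    and c :: "'a \<times> 'b \<Rightarrow> ennreal" and K :: real
    and u :: "real \<Rightarrow> 'a \<Rightarrow> real" and v :: "real \<Rightarrow> 'b \<Rightarrow> real"
  assumes "prob_space \<mu>" and "sets \<mu> = sets borel"
    and "prob_space \<nu>" and "sets \<nu> = sets borel"
    and "lower_semicontinuous c"
    and "(SUP y. \<integral>\<^sup>+ x. c (x, y) \<partial>\<mu>) \<le> ennreal K"
    and "(SUP x. \<integral>\<^sup>+ y. c (x, y) \<partial>\<nu>) \<le> ennreal K"
    and "\<And>\<epsilon>. 0 < \<epsilon> \<Longrightarrow> entropic_maximizer \<mu> \<nu> c \<epsilon> (u \<epsilon>) (v \<epsilon>)"
    and "\<And>\<epsilon>. 0 < \<epsilon> \<Longrightarrow> AE x in \<mu>. - K \<le> u \<epsilon> x \<and> u \<epsilon> x \<le> K"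
    and "\<And>\<epsilon>. 0 < \<epsilon> \<Longrightarrow> AE y in \<nu>. - K \<le> v \<epsilon> y \<and> v \<epsilon> y \<le> K"
  shows "\<exists>e :: nat \<Rightarrow> real. \<exists>u' \<in> Linfty \<mu>. \<exists>v' \<in> Linfty \<nu>.
    (\<forall>k. 0 < e k) \<and> e \<longlonglongrightarrow> 0 \<and>
    weak_star_converges \<mu> (\<lambda>k. u (e k)) u' \<and>
    weak_star_converges \<nu> (\<lambda>k. v (e k)) v' \<and>
    (\<lambda>k. entropic_dual \<mu> \<nu> c (e k) (u (e k)) (v (e k)))
      \<longlonglongrightarrow> ereal ((\<integral>x. u' x \<partial>\<mu>) + (\<integral>y. v' y \<partial>\<nu>)) \<and>
    is_arg_max (\<lambda>(u, v). (\<integral>x. u x \<partial>\<mu>) + (\<integral>y. v y \<partial>\<nu>))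
      (\<lambda>(u, v). (u, v) \<in> dual_feasible \<mu> \<nu> c) (u', v')"
proof -
  interpret M1: prob_space \<mu> by fact
  interpret M2: prob_space \<nu> by fact
  interpret pair_prob_space \<mu> \<nu> ..
  note max = assms(8)
  \<comment> \<open>Second countability identifies the product sigma-algebra with the Borel sets of
    the product, for which lower semicontinuity gives measurability.\<close>
  have "sets (\<mu> \<Otimes>\<^sub>M \<nu>) = sets (borel :: ('a \<times> 'b) measure)"
    using sets_pair_measure_cong[OF assms(2,4)] by (simp only: borel_prod)
  then have c: "c \<in> borel_measurable (\<mu> \<Otimes>\<^sub>M \<nu>)"
    using borel_measurable_lower_semicontinuous[OF assms(5)] by (simp cong: measurable_cong_sets)
  \<comment> \<open>Tonelli: integrating this bound against the probability \<open>\<mu>\<close>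
    makes the cost integrable over the product.\<close>
  have "(\<integral>\<^sup>+ y. c (x, y) \<partial>\<nu>) \<le> ennreal K" for x
    using assms(7) by (simp add: SUP_le_iff)
  then have "(\<integral>\<^sup>+ x. \<integral>\<^sup>+ y. c (x, y) \<partial>\<nu> \<partial>\<mu>) \<le> (\<integral>\<^sup>+ x. ennreal K \<partial>\<mu>)"
    by (intro nn_integral_mono)
  then have "(\<integral>\<^sup>+ z. c z \<partial>(\<mu> \<Otimes>\<^sub>M \<nu>)) \<le> ennreal K"
    by (simp add: M2.nn_integral_fst[OF c] M1.emeasure_space_1)
  then have c_fin: "(\<integral>\<^sup>+ z. c z \<partial>(\<mu> \<Otimes>\<^sub>M \<nu>)) \<noteq> \<infinity>"
    by (auto simp: top_unique)
  define d :: "nat \<Rightarrow> real" where "d k = inverse (real (Suc k))" for k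
  have d: "0 < d k" "d \<longlonglongrightarrow> 0" for k
    using LIMSEQ_inverse_real_of_nat by (auto simp: d_def[abs_def])
  have int: "integrable \<mu> (u (d k))" "integrable \<nu> (v (d k))" for k
    using max[OF d(1)] by (auto simp: entropic_maximizer_def is_arg_max_def)
  have bound: "AE x in \<mu>. \<bar>u (d k) x\<bar> \<le> K" "AE y in \<nu>. \<bar>v (d k) y\<bar> \<le> K" for k
    using assms(9,10)[OF d(1)] by (auto simp: abs_le_iff minus_le_iff elim!: eventually_mono)
  obtain r u' where r: "strict_mono (r :: nat \<Rightarrow> nat)" "weak_star_converges \<mu> (\<lambda>k. u (d (r k))) u'"
    using weak_star_convergent_subsequence[of \<mu> "\<lambda>k. u (d k)" K] assms(2) int bound
      M1.finite_measure_axioms by blast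
  \<comment> \<open>The second extraction runs along the first subsequence, so that both potentials
    converge along \<open>r (s k)\<close>.\<close>
  obtain s v' where s: "strict_mono (s :: nat \<Rightarrow> nat)" "weak_star_converges \<nu> (\<lambda>k. v (d (r (s k)))) v'"
    using weak_star_convergent_subsequence[of \<nu> "\<lambda>k. v (d (r k))" K] assms(4) int bound
      M2.finite_measure_axioms by blast
  define e where "e k = d (r (s k))" for k
  have e_pos: "0 < e k" for k by (simp add: e_def d)
  have e_lim: "e \<longlonglongrightarrow> 0"
    using LIMSEQ_subseq_LIMSEQ[OF d(2) strict_mono_compose[OF r(1) s(1)]]
    by (simp add: e_def[abs_def] o_def)
  have wu: "weak_star_converges \<mu> (\<lambda>k. u (e k)) u'"
    using weak_star_converges_subseq[OF r(2) s(1)] by (simp add: e_def)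
  have wv: "weak_star_converges \<nu> (\<lambda>k. v (e k)) v'"
    using s(2) by (simp add: e_def)
  let ?E = "\<lambda>k. entropic_penalty \<mu> \<nu> c (e k) (u (e k)) (v (e k))"
  have E: "?E k \<le> 2" for k
    by (rule entropic_maximizer_penalty_le[OF c e_pos max[OF e_pos]])
  then have E_fin: "?E k \<noteq> \<infinity>" for k
    using le_less_trans[OF E[of k], of \<infinity>] by auto
  have E_real: "enn2real (?E k) \<le> 2" for k
    using E[of k] by (intro enn2real_leI) auto
  \<comment> \<open>The penalty lies between 0 and \<open>2 * e k\<close>.\<close>
  have "(\<lambda>k. e k * enn2real (?E k)) \<longlonglongrightarrow> 0"
  proof (rule tendsto_sandwich[OF _ _ tendsto_const])
    show "(\<lambda>k. e k * 2) \<longlonglongrightarrow> 0"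
      using tendsto_mult_right[OF e_lim, of 2] by simp
  qed (use E_real e_pos in \<open>auto intro!: always_eventually mult_left_mono simp: less_imp_le\<close>)
  \<comment> \<open>With finite penalty the dual value is a real expression, and its four terms
    converge separately; the linear ones do so by weak* convergence tested against the constant
    1.\<close>
  from tendsto_add[OF tendsto_diff[OF tendsto_add[OF M1.weak_star_converges_integral[OF wu]
        M2.weak_star_converges_integral[OF wv]] this] e_lim]
  have lim: "(\<lambda>k. entropic_dual \<mu> \<nu> c (e k) (u (e k)) (v (e k)))
      \<longlonglongrightarrow> ereal ((\<integral>x. u' x \<partial>\<mu>) + (\<integral>y. v' y \<partial>\<nu>))"
    by (simp add: entropic_dual_eq_real[OF E_fin])
  have feas: "(u', v') \<in> dual_feasible \<mu> \<nu> c"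
    by (rule weak_star_limit_entropic_maximizers_feasible[OF c c_fin e_pos e_lim max[OF e_pos] wu wv])
  have opt: "(\<integral>x. a x \<partial>\<mu>) + (\<integral>y. b y \<partial>\<nu>) \<le> (\<integral>x. u' x \<partial>\<mu>) + (\<integral>y. v' y \<partial>\<nu>)"
    if ab: "(a, b) \<in> dual_feasible \<mu> \<nu> c" for a b
  proof -
    \<comment> \<open>A feasible pair competes in every regularized problem, and its linear value is
      a lower bound independent of \<open>k\<close>, so the bound survives in the limit.\<close>
    have "ereal ((\<integral>x. a x \<partial>\<mu>) + (\<integral>y. b y \<partial>\<nu>)) \<le> entropic_dual \<mu> \<nu> c (e k) (u (e k)) (v (e k))" for k
    proof -
      have "entropic_dual \<mu> \<nu> c (e k) a b \<le> entropic_dual \<mu> \<nu> c (e k) (u (e k)) (v (e k))"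
        using max[OF e_pos] ab
        by (auto simp: entropic_maximizer_def is_arg_max_def dual_feasible_def not_less)
      with dual_feasible_le_entropic_dual[OF ab e_pos] show ?thesis by (rule order_trans)
    qed
    then show ?thesis
      using LIMSEQ_le_const[OF lim] by (metis ereal_less_eq(3))
  qed
  have "is_arg_max (\<lambda>(u, v). (\<integral>x. u x \<partial>\<mu>) + (\<integral>y. v y \<partial>\<nu>))
      (\<lambda>(u, v). (u, v) \<in> dual_feasible \<mu> \<nu> c) (u', v')"
    using feas opt by (fastforce simp: is_arg_max_def not_less)
  with e_pos e_lim wu wv lim show ?thesis
    unfolding weak_star_converges_def by blast
qed

end
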